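(* Let $\mathcal{K}=[0,1]^d$ and fix a positive integer $m<d$. Let $\mathbf{x}^*=\frac12\sum_{i=1}^m\mathbf{e}_i$, i.e. $\mathbf{x}^*$ equals $\frac12$ in the first $m$ coordinates and $0$ in the rest. Consider the minimization of $f(\mathbf{x})=\frac12\|\mathbf{x}-\mathbf{x}^*\|^2$ over $\mathcal{K}$ starting at $\mathbf{x}_1=\mathbf{e}_{m+1}$, and let $f^*=\min_{\mathbf{x}\in\mathcal{K}}f(\mathbf{x})$. Then for any Frank-Wolfe-type method (defined in the context) there exists a sequence of (valid) answers returned by the linear optimization oracle such that for every $t\le\lfloor\sqrt{d-m-1}\rfloor$ the $t$-th iterate $\mathbf{x}_t$ of the method satisfies $f(\mathbf{x}_t)-f^*\ge\frac14$.
   Context: $\mathbf{e}_i$ is the $i$-th standard basis vector of $\mathbb{R}^d$ and $\|\cdot\|$ the Euclidean norm. Frank-Wolfe-type method: an iterative algorithm for $\min_{\mathbf{x}\in\mathcal{K}}f(\mathbf{x})$ ($\mathcal{K}$ convex and compact, $f$ smooth and convex) which on each iteration $t\ge1$ performs a single call to the linear optimization oracle of $\mathcal{K}$ with respect to $\nabla f(\mathbf{x}_t)$, i.e. obtains some $\mathbf{v}_t\in\arg\min_{\mathbf{v}\in\mathcal{K}}\mathbf{v}^\top\nabla f(\mathbf{x}_t)$, where $\mathbf{x}_t$ is the current iterate, and produces the next iterate $\mathbf{x}_{t+1}$ by taking some convex combination of the points in $\{\mathbf{x}_1,\mathbf{v}_1,\dots,\mathbf{v}_t\}$, where $\mathbf{x}_1$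 is the initialization point. When the linear problem has several minimizers the oracle may return any of them; a valid answer is any such minimizer. *)

theory Defs
  imports "HOL-Analysis.Analysis"
begin

definition linear_oracle_answer ::
  "'a::real_inner set \<Rightarrow> ('a \<Rightarrow> real) \<Rightarrow> 'a \<Rightarrow> 'a \<Rightarrow> bool" where
  "linear_oracle_answer K f x v \<longleftrightarrow>
     (\<exists>g. GDERIV f x :> g \<and> is_arg_min (\<lambda>u. u \<bullet> g) (\<lambda>u. u \<in> K) v)"

text \<open>
  The behaviour of a method on a problem instance \<open>(K, f, x1)\<close> is a function \<open>M\<close> sending the list
  \<open>[v\<^sub>1, \<dots>, v\<^sub>t]\<close> of oracle answers received so far to the next iterate \<open>x\<^sub>t\<^sub>+\<^sub>1\<close>.
  \<open>M\<close> may depend on the instance in any way, and the earlier iterates are themselves determined by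
  the answers, so no information is withheld from the method. Iterates and answers are numbered
  from 1; the iterate number 0 and the answer \<open>v 0\<close> play no role.
\<close>

definition iterate :: "'a \<Rightarrow> ('a list \<Rightarrow> 'a) \<Rightarrow> (nat \<Rightarrow> 'a) \<Rightarrow> nat \<Rightarrow> 'a" where
  "iterate x1 M v t = (if t \<le> 1 then x1 else M (map v [1..<t]))"

text \<open>
  The convex-combination requirement is imposed only on histories that can arise from valid
  oracle answers.
\<close>

definition frank_wolfe_type ::
  "'a::real_inner set \<Rightarrow> ('a \<Rightarrow> real) \<Rightarrow> 'a \<Rightarrow> ('a list \<Rightarrow> 'a) \<Rightarrow> bool" where
  "frank_wolfe_type K f x1 M \<longleftrightarrow>
     (\<forall>v. \<forall>t\<ge>1. (\<forall>s\<in>{1..t}. linear_oracle_answer K f (iterate x1 M v s) (v s)) \<longrightarrow>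
        iterate x1 M v (t + 1) \<in> convex hull (insert x1 (v ` {1..t})))"

end

theory Submission
  imports Defs
begin

text \<open>
  A coordinate \<open>i > m\<close> at which the iterate vanishes has zero partial derivative, so the oracle may
  set it to 1. At step \<open>s \<le> n = \<lfloor>sqrt (d - m - 1)\<rfloor>\<close> the adversary does so exactly on the \<open>s\<close>-th of
  \<open>n\<close> disjoint blocks of \<open>n\<close> coordinates beyond \<open>m + 1\<close>, which is still untouched at that time. Let
  \<open>c\<close> be 1 at coordinate \<open>m + 1\<close>, \<open>1 / n\<close> on all the blocks and 0 elsewhere. Then \<open>c \<bullet> x\<^sub>1 = 1\<close> and
  \<open>c \<bullet> v\<^sub>s = 1\<close>, hence \<open>c \<bullet> (x\<^sub>t - x\<^sup>*) = c \<bullet> x\<^sub>t = 1\<close> for every \<open>t \<le> n\<close>, and since \<open>c \<bullet> c = 2\<close> the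
  Cauchy--Schwarz inequality gives \<open>\<parallel>x\<^sub>t - x\<^sup>*\<parallel>\<^sup>2 \<ge> 1 / 2\<close>.
\<close>

lemma GDERIV_half_norm_diff_squared:
  "GDERIV (\<lambda>x. 1 / 2 * (norm (x - a))\<^sup>2) x :> x - a"
  unfolding gderiv_def power2_norm_eq_inner
  by (auto intro!: derivative_eq_intros simp: inner_commute algebra_simps)

lemma inner_mono_cart:
  fixes u v g :: "real ^ 'n"
  assumes "\<And>i. v $ i * g $ i \<le> u $ i * g $ i"
  shows "v \<bullet> g \<le> u \<bullet> g"
  unfolding inner_vec_def by (auto intro: sum_mono assms)

text \<open>A hyperplane is convex. This transfers both the zero coordinates and the value of
  \<open>c\<close> from the generators to the iterates.\<close>

lemma inner_eq_on_convex_hull: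
  assumes "x \<in> convex hull S" and "\<And>y. y \<in> S \<Longrightarrow> c \<bullet> y = b"
  shows "c \<bullet> x = b"
proof -
  have "convex hull S \<subseteq> {y. c \<bullet> y = b}"
    using assms(2) by (intro hull_minimal) (auto simp: convex_hyperplane)
  then show ?thesis using assms(1) by auto
qed

lemma iterate_cong:
  assumes "\<And>s. 1 \<le> s \<Longrightarrow> s < t \<Longrightarrow> v s = w s"
  shows "iterate x1 M v t = iterate x1 M w t"
proof -
  have "map v [1..<t] = map w [1..<t]" using assms by auto
  then show ?thesis unfolding iterate_def by metis
qed

text \<open>The equation for \<open>v\<close> is not circular: the iterate at time \<open>t\<close>
  reads only answers with index below \<open>t\<close>, so well-founded recursion yields
  \<open>v\<close>.\<close>

lemma ex_adaptive_answers:
  "\<exists>v. \<forall>t. v t = A t (iterate x1 M v t)"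
proof -
  have "\<exists>v. \<forall>t::nat. (\<lambda>v t r. r = A t (iterate x1 M v t)) v t (v t)"
  proof (rule dependent_wellorder_choice)
    fix r and v w :: "nat \<Rightarrow> 'a" and t :: nat
    assume "\<And>s. s < t \<Longrightarrow> v s = w s"
    then have "iterate x1 M v t = iterate x1 M w t" by (intro iterate_cong)
    then show "(r = A t (iterate x1 M v t)) = (r = A t (iterate x1 M w t))" by simp
  qed simp
  then show ?thesis by simp
qed

lemma iterate_in_hull:
  assumes "frank_wolfe_type K f x1 M" and "1 \<le> t"
    and "\<And>s. 1 \<le> s \<Longrightarrow> s < t \<Longrightarrow> linear_oracle_answer K f (iterate x1 M v s) (v s)"
  shows "iterate x1 M v t \<in> convex hull (insert x1 (v ` {1..<t}))"
proof (cases "t = 1")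
  case True
  then show ?thesis by (simp add: iterate_def)
next
  case False
  define r where "r = t - 1"
  have r: "t = r + 1" "1 \<le> r" using False assms(2) by (auto simp: r_def)
  have "iterate x1 M v (r + 1) \<in> convex hull (insert x1 (v ` {1..r}))"
    using assms(1,3) r unfolding frank_wolfe_type_def by auto
  moreover have "{1..r} = {1..<t}" using r by auto
  ultimately show ?thesis using r by simp
qed

text \<open>On \<open>H\<close> the gradient entry is \<open>x $ i - 1 / 2\<close>, whose sign
  decides the answer. On \<open>B\<close> it will be 0, so 1 is a free choice; elsewhere it is
  nonnegative on the cube, so 0 is optimal.\<close>

definition block_answer :: "'n set \<Rightarrow> 'n set \<Rightarrow> real ^ 'n \<Rightarrow> real ^ 'n" where
  "block_answer H B x = (\<chi> i. if i \<in> H then (if x $ i < 1 / 2 then 1 else 0)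
                              else if i \<in> B then 1 else 0)"

lemma block_answer_in_cube: "block_answer H B x \<in> cbox 0 1"
  by (auto simp: block_answer_def mem_box_cart)

text \<open>A linear objective over the cube separates, so minimizing each coordinate on its own
  suffices.\<close>

lemma block_answer_valid:
  fixes x xstar :: "real ^ 'n"
  assumes x: "x \<in> cbox 0 1" and xB: "\<And>i. i \<in> B \<Longrightarrow> x $ i = 0"
    and xstar: "\<And>i. xstar $ i = (if i \<in> H then 1 / 2 else 0)"
  shows "linear_oracle_answer (cbox 0 1) (\<lambda>x. 1 / 2 * (norm (x - xstar))\<^sup>2) x (block_answer H B x)"
proof -
  have "block_answer H B x \<bullet> (x - xstar) \<le> u \<bullet> (x - xstar)" if u: "u \<in> cbox 0 1" for u
  proof (rule inner_mono_cart)
    fix i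
    have u01: "0 \<le> u $ i" "u $ i \<le> 1" and x0: "0 \<le> x $ i"
      using u x by (auto simp: mem_box_cart)
    have "x $ i - 1 / 2 \<le> u $ i * (x $ i - 1 / 2)" if "x $ i < 1 / 2"
      using mult_right_mono_neg[OF u01(2), of "x $ i - 1 / 2"] that by simp
    then show "block_answer H B x $ i * (x - xstar) $ i \<le> u $ i * (x - xstar) $ i"
      using u01 x0 xB[of i] by (auto simp: block_answer_def xstar)
  qed
  then have "is_arg_min (\<lambda>u. u \<bullet> (x - xstar)) (\<lambda>u. u \<in> cbox 0 1) (block_answer H B x)"
    by (auto simp: is_arg_min_def block_answer_in_cube not_less)
  then show ?thesis
    unfolding linear_oracle_answer_def using GDERIV_half_norm_diff_squared by blast
qed

lemma adversarial_answers:
  fixes H :: "'n::finite set" and B :: "nat \<Rightarrow> 'n set" and xstar :: "real ^ 'n"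
  defines "f \<equiv> (\<lambda>x. 1 / 2 * (norm (x - xstar))\<^sup>2)"
  assumes xstar: "\<And>i. xstar $ i = (if i \<in> H then 1 / 2 else 0)"
    and j: "j \<notin> H"
    and disj: "disjoint_family B"
    and avoid: "\<And>s. B s \<inter> insert j H = {}"
    and card_B: "\<And>s. s \<in> {1..n} \<Longrightarrow> card (B s) = n"
    and M: "frank_wolfe_type (cbox 0 1) f (axis j 1) M"
  shows "\<exists>v. (\<forall>t\<ge>1. linear_oracle_answer (cbox 0 1) f (iterate (axis j 1) M v t) (v t)) \<and>
             (\<forall>t\<in>{1..n}. f (iterate (axis j 1) M v t) \<ge> 1 / 4)"
proof -
  define x1 :: "real ^ 'n" where "x1 = axis j 1"
  obtain v where v: "\<And>t. v t = block_answer H (B t) (iterate x1 M v t)"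
    using ex_adaptive_answers[of "\<lambda>t. block_answer H (B t)" x1 M] by blast
  \<comment> \<open>Outside \<open>H\<close> the answers ignore the iterate, so these coordinates
    are known in advance whatever \<open>M\<close> does.\<close>
  have v_tail: "v s $ i = (if i \<in> B s then 1 else 0)" if "i \<notin> H" for s i
    using that by (subst v) (simp add: block_answer_def)
  have v_cube: "v s \<in> cbox 0 1" for s
    by (subst v) (rule block_answer_in_cube)
  have M': "frank_wolfe_type (cbox 0 1) f x1 M" using M by (simp add: x1_def)
  have valid: "linear_oracle_answer (cbox 0 1) f (iterate x1 M v t) (v t)" if "1 \<le> t" for t
    using that
  \<comment> \<open>Validity at \<open>t\<close> needs the iterate to lie in the cube and to vanish
    on \<open>B t\<close>. Both follow from the hull property, which presupposes that all earlier
    answers are valid.\<close>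
  proof (induction t rule: less_induct)
    case (less t)
    have hull: "iterate x1 M v t \<in> convex hull (insert x1 (v ` {1..<t}))"
      using iterate_in_hull[OF M' less.prems] less.IH by blast
    have x1_cube: "x1 \<in> cbox 0 1" by (auto simp: x1_def mem_box_cart axis_def)
    have "convex hull (insert x1 (v ` {1..<t})) \<subseteq> cbox 0 1"
      using x1_cube v_cube by (intro hull_minimal) auto
    then have "iterate x1 M v t \<in> cbox 0 1" using hull by blast
    moreover have "iterate x1 M v t $ i = 0" if i: "i \<in> B t" for i
    proof -
      have "i \<notin> H" "i \<noteq> j" using avoid[of t] i by auto
      moreover have "i \<notin> B s" if "s < t" for s
        using disjoint_family_onD[OF disj, of s t] i that by auto
      ultimately have "axis i 1 \<bullet> y = 0" if "y \<in> insert x1 (v ` {1..<t})" for y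
        using that by (auto simp: inner_axis' x1_def v_tail) (simp add: axis_def)
      from inner_eq_on_convex_hull[OF hull this] show ?thesis by (simp add: inner_axis')
    qed
    ultimately show ?case
      unfolding f_def by (subst (2) v) (rule block_answer_valid[OF _ _ xstar])
  qed
  define U where "U = (\<Union>s\<in>{1..n}. B s)"
  define c :: "real ^ 'n" where
    "c = (\<chi> i. if i = j then 1 else if i \<in> U then 1 / real n else 0)"
  have jU: "j \<notin> U" and HU: "H \<inter> U = {}" using avoid by (auto simp: U_def)
  have c_inner: "c \<bullet> y = y $ j + (\<Sum>i\<in>U. y $ i) / n" for y
  proof -
    have "c \<bullet> y = (\<Sum>i\<in>UNIV. (if i = j then y $ i else 0) + (if i \<in> U then y $ i / n else 0))"
      unfolding inner_vec_def using jU by (intro sum.cong) (auto simp: c_def)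
    also have "\<dots> = y $ j + (\<Sum>i\<in>U. y $ i / n)"
      by (simp add: sum.distrib sum.inter_restrict[of UNIV, symmetric])
    finally show ?thesis by (simp add: sum_divide_distrib)
  qed
  have card_U: "card U = n * n"
  proof -
    have "card U = (\<Sum>s\<in>{1..n}. card (B s))"
      unfolding U_def
      by (rule card_UN_disjoint) (use disj in \<open>auto simp: disjoint_family_on_def\<close>)
    then show ?thesis using card_B by simp
  qed
  have "f (iterate x1 M v t) \<ge> 1 / 4" if t: "t \<in> {1..n}" for t
  proof -
    let ?x = "iterate x1 M v t"
    have n: "n > 0" using t by simp
    have hull: "?x \<in> convex hull (insert x1 (v ` {1..<t}))"
      using iterate_in_hull[OF M'] valid t by auto
    have "c \<bullet> x1 = 1"
      using jU by (auto simp: c_inner x1_def axis_def intro!: sum.neutral)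
    moreover have "c \<bullet> v s = 1" if s: "s \<in> {1..<t}" for s
    proof -
      \<comment> \<open>This is where the horizon enters: \<open>s < t \<le> n\<close> makes
        \<open>B s\<close> one of the blocks collected in \<open>U\<close>, so its \<open>n\<close>
        ones, each weighted by \<open>1 / n\<close>, add up to 1.\<close>
      have "B s \<subseteq> U" unfolding U_def using s t by (intro UN_upper) auto
      have "(\<Sum>i\<in>U. v s $ i) = (\<Sum>i\<in>U. if i \<in> B s then 1 else 0)"
        by (rule sum.cong[OF refl], rule v_tail) (use HU in blast)
      also have "\<dots> = card (U \<inter> B s)" by (simp add: sum.inter_restrict[symmetric])
      also have "\<dots> = n" using \<open>B s \<subseteq> U\<close> card_B[of s] s t by (simp add: Int_absorb1)
      finally show ?thesis using avoid[of s] j n by (simp add: c_inner v_tail)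
    qed
    ultimately have "c \<bullet> ?x = 1" by (intro inner_eq_on_convex_hull[OF hull]) auto
    moreover have "c \<bullet> xstar = 0"
      using j HU by (auto simp: c_inner xstar intro!: sum.neutral)
    ultimately have "c \<bullet> (?x - xstar) = 1" by (simp add: inner_diff_right)
    \<comment> \<open>Coordinate \<open>j\<close> gives 1, and the \<open>n * n\<close> coordinates
      of \<open>U\<close> give \<open>1 / n^2\<close> each.\<close>
    moreover have "c \<bullet> c = 2"
    proof -
      have "(\<Sum>i\<in>U. c $ i) = (\<Sum>i\<in>U. 1 / n)" using jU by (intro sum.cong) (auto simp: c_def)
      then have "(\<Sum>i\<in>U. c $ i) = n" using n by (simp add: card_U)
      then show ?thesis using n by (subst c_inner) (simp add: c_def)
    qed
    ultimately have "1 \<le> 2 * (norm (?x - xstar))\<^sup>2"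
      using Cauchy_Schwarz_ineq[of c "?x - xstar"] by (simp add: power2_norm_eq_inner)
    then show ?thesis by (simp add: f_def)
  qed
  then show ?thesis using valid unfolding x1_def by blast
qed

theorem theorem2:
  fixes idx :: "nat \<Rightarrow> 'd::finite" and m :: nat
    and K :: "(real ^ 'd) set" and f :: "real ^ 'd \<Rightarrow> real"
    and xstar x1 :: "real ^ 'd" and M :: "(real ^ 'd) list \<Rightarrow> real ^ 'd"
  assumes "bij_betw idx {1..CARD('d)} UNIV"
    and "1 \<le> m" and "m < CARD('d)"
    and "K = cbox 0 1"
    and "xstar = (1 / 2) *\<^sub>R (\<Sum>i = 1..m. axis (idx i) 1)"
    and "f = (\<lambda>x. 1 / 2 * (norm (x - xstar))\<^sup>2)"
    and "x1 = axis (idx (m + 1)) 1"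
    and "frank_wolfe_type K f x1 M"
  shows "\<exists>v. (\<forall>t\<ge>1. linear_oracle_answer K f (iterate x1 M v t) (v t)) \<and>
             (\<forall>t\<ge>1. int t \<le> \<lfloor>sqrt (real CARD('d) - real m - 1)\<rfloor> \<longrightarrow>
                f (iterate x1 M v t) - (INF x\<in>K. f x) \<ge> 1 / 4)"
proof -
  define D where "D = CARD('d)"
  define n where "n = nat \<lfloor>sqrt (real D - real m - 1)\<rfloor>"
  have mD: "m < D" using assms(3) by (simp add: D_def)
  have inj: "inj_on idx {1..D}" using assms(1) by (simp add: bij_betw_def D_def)
  \<comment> \<open>Room for the construction: \<open>m\<close> coordinates of \<open>H\<close>, one
    for the starting point, and \<open>n\<close> blocks of size \<open>n\<close>.\<close>
  have n_sq: "n * n + m + 1 \<le> D"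
  proof -
    have "real n \<le> sqrt (real D - real m - 1)" using mD by (simp add: n_def)
    then have "(real n)\<^sup>2 \<le> (sqrt (real D - real m - 1))\<^sup>2" by (intro power_mono) auto
    then have "real (n * n + m + 1) \<le> real D" using mD by (simp add: power2_eq_square)
    then show ?thesis by linarith
  qed
  define H where "H = idx ` {1..m}"
  \<comment> \<open>Consecutive intervals of length \<open>n\<close> starting right after
    \<open>m + 1\<close>. They are empty at times outside \<open>{1..n}\<close>, which keeps the
    family disjoint while the answers continue forever.\<close>
  define I where "I s = (if s \<in> {1..n} then {m + 2 + (s - 1) * n..<m + 2 + s * n} else {})" for s
  define B where "B s = idx ` I s" for s
  have I_bound: "I s \<subseteq> {m + 2..D}" for s
  proof (cases "s \<in> {1..n}")
    case True
    then have "s * n \<le> n * n" by simp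
    then have "m + 2 + s * n \<le> D + 1" using n_sq by linarith
    then show ?thesis using True by (auto simp: I_def)
  qed (auto simp: I_def)
  have I_sub: "I s \<subseteq> {1..D}" for s using I_bound[of s] by auto
  have xstar_nth: "xstar $ i = (if i \<in> H then 1 / 2 else 0)" for i
  proof -
    have "inj_on idx {1..m}" using inj mD by (auto intro: inj_on_subset)
    then have "(\<Sum>k = 1..m. axis (idx k) (1::real)) = (\<Sum>k\<in>H. axis k 1)"
      unfolding H_def by (simp add: sum.reindex)
    then show ?thesis by (simp add: assms(5) axis_def)
  qed
  have j: "idx (m + 1) \<notin> H"
    using inj_on_image_mem_iff[OF inj, of "m + 1" "{1..m}"] mD by (auto simp: H_def)
  have disj: "disjoint_family B"
  proof -
    have "I s \<inter> I t = {}" if "s < t" for s t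
    proof -
      \<comment> \<open>The right end of block \<open>s\<close>, which is excluded from it, is at
        most the left end of block \<open>t\<close>.\<close>
      have "s * n \<le> (t - 1) * n" using that by (intro mult_right_mono) auto
      then show ?thesis by (auto simp: I_def)
    qed
    then have "I s \<inter> I t = {}" if "s \<noteq> t" for s t
      using that by (metis Int_commute linorder_neqE_nat)
    then show ?thesis
      unfolding disjoint_family_on_def B_def
      by (metis I_sub image_empty inj inj_on_image_Int)
  qed
  have avoid: "B s \<inter> insert (idx (m + 1)) H = {}" for s
  proof -
    have "insert (idx (m + 1)) H = idx ` {1..m + 1}"
      by (auto simp: H_def atLeastAtMostSuc_conv)
    moreover have "I s \<inter> {1..m + 1} = {}" using I_bound[of s] by auto
    moreover have "{1..m + 1} \<subseteq> {1..D}" using mD by auto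
    ultimately show ?thesis
      unfolding B_def by (metis I_sub image_empty inj inj_on_image_Int)
  qed
  have card_B: "card (B s) = n" if s: "s \<in> {1..n}" for s
  proof -
    have "card (B s) = card (I s)"
      unfolding B_def by (rule card_image) (rule inj_on_subset[OF inj I_sub])
    also have "\<dots> = s * n - (s - 1) * n" using s by (simp add: I_def)
    also have "\<dots> = n" using s by (simp flip: diff_mult_distrib)
    finally show ?thesis .
  qed
  have "xstar \<in> K" by (auto simp: assms(4) mem_box_cart xstar_nth)
  moreover have "f xstar = 0" and "\<And>x. 0 \<le> f x" by (simp_all add: assms(6))
  \<comment> \<open>The infimum is attained at \<open>xstar\<close>, so the gap to the optimum is
    the value of \<open>f\<close> itself.\<close>
  ultimately have "(INF x\<in>K. f x) = 0"
    by (intro cInf_eq_minimum) (force simp: image_iff, blast)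
  moreover obtain v where
    "\<forall>t\<ge>1. linear_oracle_answer K f (iterate x1 M v t) (v t)"
    "\<forall>t\<in>{1..n}. f (iterate x1 M v t) \<ge> 1 / 4"
    using adversarial_answers[OF xstar_nth j disj avoid card_B, of M] assms(4,6,7,8) by blast
  moreover have "t \<le> n" if "int t \<le> \<lfloor>sqrt (real CARD('d) - real m - 1)\<rfloor>" for t
    using that by (simp add: n_def D_def le_nat_iff)
  ultimately show ?thesis by auto
qed

end
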